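(* There exists exactly one $h^*\in(0,1)$ that is a steady state, i.e. exactly one $h^*\in(0,1)$ for which there is $\mu^*\in\mathbb R$ such that the constant functions $h(t)\equiv h^*$, $\ell(t)\equiv h^*$, $\mu(t)\equiv\mu^*$ satisfy the system $$\dot\mu=-u_h(\ell,h)+\mu(\phi+\rho),\qquad u_\ell(\ell,h)+v_\ell(\ell)+\mu\phi=0,\qquad \dot h=\phi(\ell-h),\qquad \lim_{t\to+\infty}h(t)\mu(t)e^{-\rho t}=0 .$$
   Context: Parameters: $\rho>0$, $\phi>0$, $B>0$, $\sigma>1$, $\gamma<1$ with $\gamma(\sigma-1)>1$ (so $0<\gamma<1$), and $\tilde B=B^{1-\sigma}$. For $\ell\in(0,1)$ and $h>0$, $$u(\ell,h)=\frac{\left(\frac{\ell}{h^\gamma}\right)^{1-\sigma}}{1-\sigma},\qquad v(\ell)=\tilde B\,\frac{(1-\ell)^{1-\sigma}}{1-\sigma},$$ and subscripts denote partial derivatives. The system displayed in the claim consists of the first-order (Maximum Principle) conditions for an interior solution of the problem of maximizing $\int_0^\infty e^{-\rho t}[u(\ell(t),h(t))+v(\ell(t))]\,dt$ subject to $\dot h=\phi(\ell-h)$, with costate $\mu$. A steady state is a stationary solution of this system ($\dot h=\dot\mu=0$), which forces $\ell=h=h^*$; it is identified with the value $h^*$. *)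

theory Defs
  imports "HOL-Analysis.Analysis"
begin

(* The formulas for u and v are meant for 0 < l < 1 and h > 0; outside this range
   they take whatever values the library's powr gives. *)

definition util_u :: "real \<Rightarrow> real \<Rightarrow> real \<Rightarrow> real \<Rightarrow> real" where
  "util_u \<sigma> \<gamma> l h = (l / h powr \<gamma>) powr (1 - \<sigma>) / (1 - \<sigma>)"

definition B_tilde :: "real \<Rightarrow> real \<Rightarrow> real" where
  "B_tilde B \<sigma> = B powr (1 - \<sigma>)"

definition util_v :: "real \<Rightarrow> real \<Rightarrow> real \<Rightarrow> real" where
  "util_v B \<sigma> l = B_tilde B \<sigma> * ((1 - l) powr (1 - \<sigma>) / (1 - \<sigma>))"

definition u_l :: "real \<Rightarrow> real \<Rightarrow> real \<Rightarrow> real \<Rightarrow> real" where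
  "u_l \<sigma> \<gamma> l h = deriv (\<lambda>x. util_u \<sigma> \<gamma> x h) l"

definition u_h :: "real \<Rightarrow> real \<Rightarrow> real \<Rightarrow> real \<Rightarrow> real" where
  "u_h \<sigma> \<gamma> l h = deriv (\<lambda>x. util_u \<sigma> \<gamma> l x) h"

definition v_l :: "real \<Rightarrow> real \<Rightarrow> real \<Rightarrow> real" where
  "v_l B \<sigma> l = deriv (util_v B \<sigma>) l"

(* Time ranges over [0, \<infinity>), so the derivative at t = 0 is one-sided. *)
definition foc_system ::
  "real \<Rightarrow> real \<Rightarrow> real \<Rightarrow> real \<Rightarrow> real \<Rightarrow> (real \<Rightarrow> real) \<Rightarrow> (real \<Rightarrow> real) \<Rightarrow> (real \<Rightarrow> real) \<Rightarrow> bool" where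
  "foc_system \<rho> \<phi> B \<sigma> \<gamma> h l \<mu> \<longleftrightarrow>
     (\<forall>t\<ge>0. (\<mu> has_real_derivative (- u_h \<sigma> \<gamma> (l t) (h t) + \<mu> t * (\<phi> + \<rho>))) (at t within {0..})) \<and>
     (\<forall>t\<ge>0. u_l \<sigma> \<gamma> (l t) (h t) + v_l B \<sigma> (l t) + \<mu> t * \<phi> = 0) \<and>
     (\<forall>t\<ge>0. (h has_real_derivative (\<phi> * (l t - h t))) (at t within {0..})) \<and>
     ((\<lambda>t. h t * \<mu> t * exp (- \<rho> * t)) \<longlongrightarrow> 0) at_top"

definition steady_state :: "real \<Rightarrow> real \<Rightarrow> real \<Rightarrow> real \<Rightarrow> real \<Rightarrow> real \<Rightarrow> bool" where
  "steady_state \<rho> \<phi> B \<sigma> \<gamma> hs \<longleftrightarrow>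
     (\<exists>\<mu>s. foc_system \<rho> \<phi> B \<sigma> \<gamma> (\<lambda>t. hs) (\<lambda>t. hs) (\<lambda>t. \<mu>s))"

end

theory Submission
  imports Defs
begin

text \<open>
  Along a constant path with \<open>\<ell> = h\<close>, the costate equation is linear in \<open>\<mu>\<close> and determines
  \<open>\<mu> = u\<^sub>h / (\<phi> + \<rho>)\<close>; the transversality condition is then automatic because \<open>\<rho> > 0\<close>. The
  utility \<open>u\<close> is a product of powers of \<open>\<ell>\<close> and \<open>h\<close>, so on the diagonal \<open>u\<^sub>\<ell>\<close> and \<open>u\<^sub>h\<close> are
  multiples of the same power \<open>h powr (-p)\<close> with \<open>p = \<sigma> - \<gamma>(\<sigma> - 1)\<close>, namely with coefficients \<open>1\<close>
  and \<open>-\<gamma>\<close>. Eliminating \<open>\<mu>\<close> from the remaining first-order condition and clearing the negative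
  powers leaves one scalar equation
  \<open>B_tilde B \<sigma> * h powr p = (1 - \<phi> * \<gamma> / (\<phi> + \<rho>)) * (1 - h) powr \<sigma>\<close>
  (lemma \<open>steady_state_iff_power_balance\<close>).

  Since \<open>\<gamma> < 1 < \<sigma>\<close>, both \<open>p\<close> and the coefficient on the right are positive. Hence the left side
  increases strictly from \<open>0\<close> to \<open>B_tilde B \<sigma>\<close> on \<open>[0,1]\<close>, the right side decreases strictly to \<open>0\<close>,
  and they cross exactly once (lemma \<open>power_balance_unique_solution\<close>).
\<close>

section \<open>Marginal utilities on the diagonal\<close>

lemma u_l_diagonal:
  assumes "\<sigma> \<noteq> 1" and "h > 0"
  shows "u_l \<sigma> \<gamma> h h = h powr (- (\<sigma> - \<gamma> * (\<sigma> - 1)))"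
proof -
  define k where "k = h powr (- \<gamma> * (1 - \<sigma>))"
  have split: "util_u \<sigma> \<gamma> x h = x powr (1 - \<sigma>) * k / (1 - \<sigma>)" if "x > 0" for x
    using that assms(2) unfolding util_u_def k_def
    by (simp add: powr_divide powr_powr powr_minus_divide)
  have "((\<lambda>x. x powr (1 - \<sigma>) * k / (1 - \<sigma>)) has_real_derivative
      ((1 - \<sigma>) * h powr (1 - \<sigma> - 1)) * k / (1 - \<sigma>)) (at h)"
    using assms by (auto intro!: derivative_eq_intros)
  then have "((\<lambda>x. util_u \<sigma> \<gamma> x h) has_real_derivative
      ((1 - \<sigma>) * h powr (1 - \<sigma> - 1)) * k / (1 - \<sigma>)) (at h)"
    by (rule has_field_derivative_transform_within_open[where S = "{0<..}"])
       (use assms(2) split in auto)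
  then have "u_l \<sigma> \<gamma> h h = ((1 - \<sigma>) * h powr (1 - \<sigma> - 1)) * k / (1 - \<sigma>)"
    unfolding u_l_def by (rule DERIV_imp_deriv)
  also have "\<dots> = h powr (- \<sigma>) * k"
    using assms(1) by simp
  finally show ?thesis
    by (simp add: k_def powr_add[symmetric] algebra_simps)
qed

lemma u_h_diagonal:
  assumes "\<sigma> \<noteq> 1" and "h > 0"
  shows "u_h \<sigma> \<gamma> h h = - \<gamma> * h powr (- (\<sigma> - \<gamma> * (\<sigma> - 1)))"
proof -
  define k where "k = h powr (1 - \<sigma>)"
  define a where "a = - \<gamma> * (1 - \<sigma>)"
  have split: "util_u \<sigma> \<gamma> h x = k * x powr a / (1 - \<sigma>)" if "x > 0" for x
    using that assms(2) unfolding util_u_def k_def a_def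
    by (simp add: powr_divide powr_powr powr_minus_divide)
  have "((\<lambda>x. k * x powr a / (1 - \<sigma>)) has_real_derivative k * (a * h powr (a - 1)) / (1 - \<sigma>)) (at h)"
    using assms by (auto intro!: derivative_eq_intros)
  then have "((\<lambda>x. util_u \<sigma> \<gamma> h x) has_real_derivative k * (a * h powr (a - 1)) / (1 - \<sigma>)) (at h)"
    by (rule has_field_derivative_transform_within_open[where S = "{0<..}"])
       (use assms(2) split in auto)
  then have "u_h \<sigma> \<gamma> h h = k * (a * h powr (a - 1)) / (1 - \<sigma>)"
    unfolding u_h_def by (rule DERIV_imp_deriv)
  also have "\<dots> = - \<gamma> * (k * h powr (a - 1))"
    using assms(1) by (simp add: a_def field_simps)
  also have "k * h powr (a - 1) = h powr (- (\<sigma> - \<gamma> * (\<sigma> - 1)))"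
    by (simp add: k_def a_def powr_add[symmetric] algebra_simps)
  finally show ?thesis .
qed

lemma v_l_eq:
  assumes "\<sigma> \<noteq> 1" and "l < 1"
  shows "v_l B \<sigma> l = - B_tilde B \<sigma> * (1 - l) powr (- \<sigma>)"
proof -
  have "((\<lambda>x. B_tilde B \<sigma> * ((1 - x) powr (1 - \<sigma>) / (1 - \<sigma>)))
      has_real_derivative B_tilde B \<sigma> * (((1 - \<sigma>) * (1 - l) powr (1 - \<sigma> - 1) * (- 1)) / (1 - \<sigma>))) (at l)"
    using assms by (auto intro!: derivative_eq_intros)
  then have "v_l B \<sigma> l = B_tilde B \<sigma> * (((1 - \<sigma>) * (1 - l) powr (1 - \<sigma> - 1) * (- 1)) / (1 - \<sigma>))"
    unfolding v_l_def util_v_def by (rule DERIV_imp_deriv)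
  then show ?thesis
    using assms(1) by simp
qed

section \<open>Reduction to a scalar equation\<close>

text \<open>
  On constant paths the differential equations become algebraic by uniqueness of the derivative,
  and the transversality condition holds for every \<open>\<mu>\<close> since \<open>exp (-\<rho> t)\<close> tends to \<open>0\<close>.
\<close>

lemma foc_system_const_iff:
  assumes "\<rho> > 0"
  shows "foc_system \<rho> \<phi> B \<sigma> \<gamma> (\<lambda>t. h) (\<lambda>t. h) (\<lambda>t. \<mu>) \<longleftrightarrow>
    \<mu> * (\<phi> + \<rho>) = u_h \<sigma> \<gamma> h h \<and> u_l \<sigma> \<gamma> h h + v_l B \<sigma> h + \<mu> * \<phi> = 0"
proof -
  have "(((\<lambda>t. \<mu>) has_real_derivative D) (at t within {0..})) \<longleftrightarrow> D = 0" if "t \<ge> 0" for t D :: real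
  proof
    assume D: "((\<lambda>t. \<mu>) has_real_derivative D) (at t within {0..})"
    \<comment> \<open>At the endpoint \<open>t = 0\<close> the one-sided derivative is still unique, because \<open>0\<close> is a limit
      point of the half line; the intervals \<open>{t..t + 1}\<close> treat all \<open>t\<close> alike.\<close>
    have "at t within {t..t + 1} \<noteq> bot" "at t within {t..t + 1} \<le> at t within {0..}"
      using that by (auto simp: trivial_limit_within islimpt_Icc intro!: at_le)
    then have "at t within {0..} \<noteq> bot"
      by (metis bot.extremum_uniqueI)
    from has_field_derivative_unique[OF D _ this, of 0] show "D = 0"
      by simp
  qed simp
  moreover have "((\<lambda>t. h * \<mu> * exp (- \<rho> * t)) \<longlongrightarrow> 0) at_top"
  proof -
    have "filterlim (\<lambda>t. - \<rho> * t) at_bot at_top"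
      using assms by (intro filterlim_tendsto_neg_mult_at_bot[OF tendsto_const]) (auto simp: filterlim_ident)
    then have "((\<lambda>t. exp (- \<rho> * t)) \<longlongrightarrow> 0) at_top"
      by (rule filterlim_compose[OF exp_at_bot])
    then show ?thesis
      by (rule tendsto_mult_right_zero)
  qed
  ultimately show ?thesis
    unfolding foc_system_def by (auto simp: algebra_simps)
qed

lemma steady_state_iff_power_balance:
  assumes "\<rho> > 0" and "\<phi> > 0" and "\<sigma> \<noteq> 1" and "0 < h" and "h < 1"
  shows "steady_state \<rho> \<phi> B \<sigma> \<gamma> h \<longleftrightarrow>
    B_tilde B \<sigma> * h powr (\<sigma> - \<gamma> * (\<sigma> - 1)) = (1 - \<phi> * \<gamma> / (\<phi> + \<rho>)) * (1 - h) powr \<sigma>"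
proof -
  define p where "p = \<sigma> - \<gamma> * (\<sigma> - 1)"
  define P where "P = h powr p"
  define Q where "Q = (1 - h) powr \<sigma>"
  have pos: "P > 0" "Q > 0" "\<phi> + \<rho> > 0"
    using assms by (auto simp: P_def Q_def)
  have "steady_state \<rho> \<phi> B \<sigma> \<gamma> h \<longleftrightarrow>
    (\<exists>\<mu>. \<mu> * (\<phi> + \<rho>) = - \<gamma> / P \<and> 1 / P - B_tilde B \<sigma> / Q + \<mu> * \<phi> = 0)"
    using assms unfolding steady_state_def
    by (simp add: foc_system_const_iff u_l_diagonal u_h_diagonal v_l_eq P_def Q_def p_def powr_minus_divide
             del: minus_diff_eq)
  also have "\<dots> \<longleftrightarrow> 1 / P - B_tilde B \<sigma> / Q - \<gamma> / P / (\<phi> + \<rho>) * \<phi> = 0"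
  proof -
    have "\<mu> * (\<phi> + \<rho>) = - \<gamma> / P \<longleftrightarrow> \<mu> = - (\<gamma> / P / (\<phi> + \<rho>))" for \<mu>
      using pos eq_divide_eq[of \<mu> "- \<gamma> / P" "\<phi> + \<rho>"] by auto
    then show ?thesis
      by simp
  qed
  also have "\<dots> \<longleftrightarrow> B_tilde B \<sigma> * P = (1 - \<phi> * \<gamma> / (\<phi> + \<rho>)) * Q"
  proof -
    have "1 / P - B_tilde B \<sigma> / Q - \<gamma> / P / (\<phi> + \<rho>) * \<phi>
        = ((1 - \<phi> * \<gamma> / (\<phi> + \<rho>)) * Q - B_tilde B \<sigma> * P) / (P * Q)"
      using pos by (simp add: divide_simps) (simp add: algebra_simps)
    then show ?thesis
      using pos by auto
  qed
  finally show ?thesis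
    by (simp add: P_def Q_def p_def)
qed

section \<open>The scalar equation\<close>

text \<open>
  The negative powers have been cleared precisely so that the difference of the two sides extends
  continuously and strictly monotonically to the closed interval, with signs that can be read off
  at its ends.
\<close>

lemma power_balance_unique_solution:
  fixes b c p q :: real
  assumes "b > 0" and "c > 0" and "p > 0" and "q > 0"
  shows "\<exists>!x. 0 < x \<and> x < 1 \<and> b * x powr p = c * (1 - x) powr q"
proof -
  define g where "g x = b * x powr p - c * (1 - x) powr q" for x
  have g_mono: "g x < g y" if "0 \<le> x" "x < y" "y \<le> 1" for x y
  proof -
    have "x powr p < y powr p" "(1 - y) powr q < (1 - x) powr q"
      using that assms by (auto intro!: powr_less_mono2)
    then have "b * x powr p < b * y powr p" "c * (1 - y) powr q < c * (1 - x) powr q"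
      using assms by simp_all
    then show ?thesis
      unfolding g_def by linarith
  qed
  have "continuous_on {0..1} g"
    unfolding g_def using assms by (intro continuous_intros continuous_on_powr') auto
  moreover have "g 0 < 0" "g 1 > 0"
    using assms by (auto simp: g_def)
  ultimately obtain x where x: "0 \<le> x" "x \<le> 1" "g x = 0"
    using IVT'[of g 0 0 1] by auto
  with \<open>g 0 < 0\<close> \<open>g 1 > 0\<close> have "x \<noteq> 0" "x \<noteq> 1"
    by auto
  with x have "0 < x \<and> x < 1 \<and> g x = 0"
    by auto
  moreover have "y = z" if "0 < y \<and> y < 1 \<and> g y = 0" "0 < z \<and> z < 1 \<and> g z = 0" for y z
    using g_mono[of y z] g_mono[of z y] that by (cases y z rule: linorder_cases) auto
  ultimately have "\<exists>!x. 0 < x \<and> x < 1 \<and> g x = 0"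
    by blast
  then show ?thesis
    by (simp add: g_def)
qed

section \<open>Existence and uniqueness of the steady state\<close>

theorem proposition5:
  fixes \<rho> \<phi> B \<sigma> \<gamma> :: real
  assumes "\<rho> > 0" and "\<phi> > 0" and "B > 0" and "\<sigma> > 1" and "\<gamma> < 1" and "\<gamma> * (\<sigma> - 1) > 1"
  shows "\<exists>!hs. 0 < hs \<and> hs < 1 \<and> steady_state \<rho> \<phi> B \<sigma> \<gamma> hs"
proof -
  have "\<gamma> * (\<sigma> - 1) < 1 * (\<sigma> - 1)"
    using assms by (intro mult_strict_right_mono) auto
  then have exponent: "\<sigma> - \<gamma> * (\<sigma> - 1) > 0"
    by simp
  have "\<phi> * \<gamma> < \<phi> * 1"
    using assms by (intro mult_strict_left_mono) auto
  then have "\<phi> * \<gamma> < \<phi> + \<rho>"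
    using assms(1) by linarith
  then have coefficient: "1 - \<phi> * \<gamma> / (\<phi> + \<rho>) > 0"
    using assms by simp
  have "B_tilde B \<sigma> > 0"
    using assms by (simp add: B_tilde_def)
  from power_balance_unique_solution[OF this coefficient exponent, of \<sigma>]
  have "\<exists>!hs. 0 < hs \<and> hs < 1 \<and>
      B_tilde B \<sigma> * hs powr (\<sigma> - \<gamma> * (\<sigma> - 1)) = (1 - \<phi> * \<gamma> / (\<phi> + \<rho>)) * (1 - hs) powr \<sigma>"
    using assms by simp
  then show ?thesis
    using assms by (simp add: steady_state_iff_power_balance cong: conj_cong)
qed

end
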